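(* Let $M$ and $M'$ be matroids without loops and without coloops. For a matroid $N$ let $\mathcal Z(N)$ denote the set of cyclic flats of $N$, partially ordered by inclusion. Suppose there is a bijection $\varphi:\mathcal Z(M)\to\mathcal Z(M')$ such that for all $X,Y\in\mathcal Z(M)$: $X\subseteq Y$ if and only if $\varphi(X)\subseteq\varphi(Y)$, $|\varphi(X)|=|X|$, and $r_{M'}(\varphi(X))=r_M(X)$. Then $R_M(x,y)=R_{M'}(x,y)$, where for a matroid $N$ with ground set $E$ and rank function $r_N$ the rank generating polynomial is $$R_N(x,y)=\sum_{X\subseteq E} x^{r_N(E)-r_N(X)}\,y^{|X|-r_N(X)}.$$ Consequently the Tutte polynomial $T_N(x,y)=R_N(x-1,y-1)$ of a matroid without loops and coloops is determined by its configuration.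
   Context: A flat $X$ of a matroid $N$ is called cyclic if the restriction $N|X$ has no coloops. The set of cyclic flats forms a lattice under inclusion. The configuration of $N$ consists of the isomorphism class of the lattice $(\mathcal Z(N),\subseteq)$ together with the cardinality and rank of each cyclic flat; the hypothesis on $\varphi$ says exactly that $M$ and $M'$ have the same configuration. *)

theory Defs
  imports "HOL-Computational_Algebra.Polynomial"
begin

record 'a set_system =
  ground :: "'a set"
  indeps :: "'a set set"

locale matroid =
  fixes M :: "'a set_system"
  assumes finite_ground: "finite (ground M)"
    and indep_subset_ground: "I \<in> indeps M \<Longrightarrow> I \<subseteq> ground M"
    and indep_empty: "{} \<in> indeps M"
    and indep_subset: "I \<in> indeps M \<Longrightarrow> J \<subseteq> I \<Longrightarrow> J \<in> indeps M"
    and indep_augment: "I \<in> indeps M \<Longrightarrow> J \<in> indeps M \<Longrightarrow> card I < card J \<Longrightarrow>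
      \<exists>e\<in>J - I. insert e I \<in> indeps M"

definition rk :: "'a set_system \<Rightarrow> 'a set \<Rightarrow> nat" where
  "rk M X = Max (card ` {I \<in> indeps M. I \<subseteq> X})"

definition bases :: "'a set_system \<Rightarrow> 'a set set" where
  "bases M = {B \<in> indeps M. \<forall>I\<in>indeps M. B \<subseteq> I \<longrightarrow> I = B}"

definition loops :: "'a set_system \<Rightarrow> 'a set" where
  "loops M = {e \<in> ground M. {e} \<notin> indeps M}"

definition coloops :: "'a set_system \<Rightarrow> 'a set" where
  "coloops M = {e \<in> ground M. \<forall>B\<in>bases M. e \<in> B}"

definition restriction :: "'a set_system \<Rightarrow> 'a set \<Rightarrow> 'a set_system" where
  "restriction M X = \<lparr>ground = X, indeps = {I \<in> indeps M. I \<subseteq> X}\<rparr>"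

definition flats :: "'a set_system \<Rightarrow> 'a set set" where
  "flats M = {X. X \<subseteq> ground M \<and> (\<forall>e\<in>ground M - X. rk M X < rk M (insert e X))}"

definition cyclic_flats :: "'a set_system \<Rightarrow> 'a set set" where
  "cyclic_flats M = {X \<in> flats M. coloops (restriction M X) = {}}"

text \<open>
  A polynomial in \<open>x, y\<close> with integer coefficients is a polynomial in \<open>x\<close> whose
  coefficients are polynomials in \<open>y\<close>.
\<close>

definition var_x :: "int poly poly" where
  "var_x = [:0, 1:]"

definition var_y :: "int poly poly" where
  "var_y = [:[:0, 1:]:]"

definition eval_xy :: "int poly poly \<Rightarrow> 'r::comm_ring_1 \<Rightarrow> 'r \<Rightarrow> 'r" where
  "eval_xy p a b = poly (map_poly (\<lambda>q. poly (map_poly of_int q) b) p) a"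

text \<open>
  In a matroid the natural-number subtractions below do not truncate, as the rank is
  monotone and bounded by the cardinality.
\<close>

definition rank_gen_poly :: "'a set_system \<Rightarrow> int poly poly" where
  "rank_gen_poly M = (\<Sum>X\<in>Pow (ground M).
     var_x ^ (rk M (ground M) - rk M X) * var_y ^ (card X - rk M X))"

definition tutte_poly :: "'a set_system \<Rightarrow> int poly poly" where
  "tutte_poly M = eval_xy (rank_gen_poly M) (var_x - 1) (var_y - 1)"

end

theory Submission
  imports Defs
begin

text \<open>
  Removing the coloops of a set \<open>X\<close> leaves a set \<open>Y\<close> whose closure \<open>V\<close> is a cyclic flat; \<open>Y\<close> is a
  coloop-free spanning subset of \<open>V\<close>, and \<open>X - V\<close> is independent in the contraction \<open>M/V\<close>. Hence
  \<open>X \<mapsto> (V, X \<inter> V, X - V)\<close> is a bijection, and the rank generating polynomial is a sum over the cyclic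
  flats \<open>V\<close> of products of a factor counting the sets \<open>Y\<close> by size and a factor counting the sets
  \<open>X - V\<close> by size. The same decomposition applies to every minor \<open>(M|W)/Z\<close> with cyclic flats
  \<open>Z \<subset> W\<close>. Counting all its subsets, the numbers of coloop-free spanning sets and of independent sets of
  a given size add up to something known by induction on \<open>|W| - |Z|\<close>; they can be told apart because
  an independent set has size at most \<open>r(W) - r(Z)\<close>, while a coloop-free spanning set is larger.
\<close>

section \<open>Rank\<close>

context matroid
begin

lemma finite_indeps_within: "finite {I \<in> indeps M. I \<subseteq> X}"
  by (rule finite_subset[of _ "Pow (ground M)"]) (use finite_ground indep_subset_ground in auto)

lemma finite_indep: "I \<in> indeps M \<Longrightarrow> finite I"
  using indep_subset_ground finite_ground finite_subset by blast

lemma card_le_rk: "I \<in> indeps M \<Longrightarrow> I \<subseteq> X \<Longrightarrow> card I \<le> rk M X"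
  unfolding rk_def by (rule Max_ge) (use finite_indeps_within in auto)

lemma rk_witness:
  obtains I where "I \<in> indeps M" "I \<subseteq> X" "card I = rk M X"
proof -
  have "rk M X \<in> card ` {I \<in> indeps M. I \<subseteq> X}"
    unfolding rk_def by (rule Max_in) (use finite_indeps_within indep_empty in auto)
  then obtain I where "I \<in> indeps M" "I \<subseteq> X" "rk M X = card I" by blast
  then show thesis using that[of I] by simp
qed

lemma rk_mono: "A \<subseteq> B \<Longrightarrow> rk M A \<le> rk M B"
proof -
  assume "A \<subseteq> B"
  moreover obtain I where "I \<in> indeps M" "I \<subseteq> A" "card I = rk M A" using rk_witness .
  ultimately show ?thesis using card_le_rk[of I B] by auto
qed

lemma rk_le_card: "finite X \<Longrightarrow> rk M X \<le> card X"
proof -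
  assume "finite X"
  moreover obtain I where "I \<subseteq> X" "card I = rk M X" using rk_witness .
  ultimately show ?thesis using card_mono[of X I] by simp
qed

lemma indep_extend:
  assumes "I \<in> indeps M" "I \<subseteq> X"
  obtains J where "J \<in> indeps M" "I \<subseteq> J" "J \<subseteq> X" "card J = rk M X"
proof -
  have "\<exists>J\<in>indeps M. I \<subseteq> J \<and> J \<subseteq> X \<and> card J = rk M X"
    using assms
  proof (induction "rk M X - card I" arbitrary: I)
    case 0
    then have "card I = rk M X" using card_le_rk[of I X] by simp
    then show ?case using 0 by blast
  next
    case (Suc n)
    obtain K where K: "K \<in> indeps M" "K \<subseteq> X" "card K = rk M X" using rk_witness .
    obtain e where e: "e \<in> K - I" "insert e I \<in> indeps M"
      using indep_augment[OF Suc.prems(1) K(1)] Suc.hyps(2) K(3)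
      by (metis diff_is_0_eq nat.distinct(1) not_le)
    have "n = rk M X - card (insert e I)"
      using Suc.hyps(2) e finite_indep[OF Suc.prems(1)] by simp
    then show ?case
      using Suc.hyps(1)[of "insert e I"] e(1,2) K(2) Suc.prems(2) by auto
  qed
  then show thesis using that by blast
qed

text \<open>Extend a basis \<open>I\<close> of \<open>A \<inter> B\<close> to a basis
  \<open>K\<close> of \<open>A \<union> B\<close>. Both \<open>K \<inter> A\<close> and
  \<open>K \<inter> B\<close> are independent and their intersection contains \<open>I\<close>, so
  inclusion-exclusion gives the bound.\<close>

lemma rk_submodular: "rk M (A \<union> B) + rk M (A \<inter> B) \<le> rk M A + rk M B"
proof -
  obtain I where I: "I \<in> indeps M" "I \<subseteq> A \<inter> B" "card I = rk M (A \<inter> B)" using rk_witness .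
  obtain K where K: "K \<in> indeps M" "I \<subseteq> K" "K \<subseteq> A \<union> B" "card K = rk M (A \<union> B)"
    by (rule indep_extend[of I "A \<union> B"]) (use I in auto)
  have fin: "finite K" using finite_indep[OF K(1)] .
  have "card (K \<inter> A) + card (K \<inter> B) = card ((K \<inter> A) \<union> (K \<inter> B)) + card ((K \<inter> A) \<inter> (K \<inter> B))"
    using fin by (intro card_Un_Int) auto
  moreover have "card ((K \<inter> A) \<union> (K \<inter> B)) = card K"
    using K(3) by (intro arg_cong[of _ _ card]) blast
  moreover have "card I \<le> card ((K \<inter> A) \<inter> (K \<inter> B))"
    using fin I(2) K(2) by (intro card_mono) auto
  moreover have "card (K \<inter> A) \<le> rk M A" "card (K \<inter> B) \<le> rk M B"
    using indep_subset[OF K(1)] by (simp_all add: card_le_rk)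
  ultimately show ?thesis using I(3) K(4) by linarith
qed

lemma rk_Un_le:
  assumes "finite B"
  shows "rk M (A \<union> B) \<le> rk M A + card B"
  using rk_submodular[of A B] rk_le_card[OF assms] by linarith

text \<open>A set of full rank in \<open>B\<close> can replace \<open>B\<close> in any union. This
  is submodularity for \<open>B\<close> and \<open>A \<union> C\<close>, whose intersection contains
  \<open>A\<close>.\<close>

lemma rk_Un_cong:
  assumes "A \<subseteq> B" "rk M A = rk M B"
  shows "rk M (A \<union> C) = rk M (B \<union> C)"
proof (rule antisym)
  show "rk M (A \<union> C) \<le> rk M (B \<union> C)" using assms(1) by (intro rk_mono) auto
  have "rk M (B \<union> (A \<union> C)) + rk M (B \<inter> (A \<union> C)) \<le> rk M B + rk M (A \<union> C)"
    by (rule rk_submodular)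
  moreover have "B \<union> (A \<union> C) = B \<union> C" using assms(1) by auto
  moreover have "rk M A \<le> rk M (B \<inter> (A \<union> C))" using assms(1) by (intro rk_mono) auto
  ultimately show "rk M (B \<union> C) \<le> rk M (A \<union> C)" using assms(2) by simp
qed

text \<open>Here \<open>e\<close> is spanned by \<open>A - {e}\<close>, hence by the larger
  \<open>B - {e}\<close>. Contrapositively, a coloop stays a coloop in every smaller set that
  contains it.\<close>

lemma noncoloop_mono:
  assumes "rk M (A - {e}) = rk M A" "e \<in> A" "A \<subseteq> B"
  shows "rk M (B - {e}) = rk M B"
proof -
  have "rk M ((A - {e}) \<union> (B - {e})) = rk M (A \<union> (B - {e}))"
    by (rule rk_Un_cong) (use assms in auto)
  moreover have "(A - {e}) \<union> (B - {e}) = B - {e}" "A \<union> (B - {e}) = B" using assms by auto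
  ultimately show ?thesis by simp
qed

text \<open>The elements of \<open>T\<close> are coloops of the restriction to \<open>S\<close>. By
  \<open>noncoloop_mono\<close> they remain coloops while others are deleted, so each deletion
  lowers the rank by exactly one.\<close>

lemma rk_Diff_coloops:
  assumes "finite T" "T \<subseteq> S" "\<And>e. e \<in> T \<Longrightarrow> rk M (S - {e}) \<noteq> rk M S"
  shows "rk M S = rk M (S - T) + card T"
  using assms
proof (induction T rule: finite_induct)
  case (insert e T)
  have *: "insert e (S - insert e T) = S - T" using insert by auto
  have "rk M (S - T - {e}) \<noteq> rk M (S - T)"
    using noncoloop_mono[of "S - T" e S] insert by auto
  moreover have "S - T - {e} = S - insert e T" by auto
  moreover have "rk M (S - insert e T) \<le> rk M (S - T)" by (intro rk_mono) auto
  moreover have "rk M (S - T) \<le> rk M (S - insert e T) + 1"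
    using rk_Un_le[of "{e}" "S - insert e T"] * by simp
  ultimately have "rk M (S - T) = rk M (S - insert e T) + 1" by simp
  then show ?case using insert by auto
qed simp

section \<open>Closure and cyclic flats\<close>

definition closure :: "'a set \<Rightarrow> 'a set" where
  "closure X = {e \<in> ground M. rk M (insert e X) = rk M X}"

lemma closure_superset: "X \<subseteq> ground M \<Longrightarrow> X \<subseteq> closure X"
  by (auto simp: closure_def insert_absorb)

lemma rk_Un_absorb:
  assumes "finite T" "\<And>e. e \<in> T \<Longrightarrow> rk M (insert e X) = rk M X"
  shows "rk M (X \<union> T) = rk M X"
  using assms
proof (induction T rule: finite_induct)
  case (insert e T)
  then show ?case using rk_Un_cong[of X "X \<union> T" "{e}"] by simp
qed simp

lemma rk_closure:
  assumes "X \<subseteq> ground M"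
  shows "rk M (closure X) = rk M X"
proof -
  have "rk M (X \<union> closure X) = rk M X"
    by (rule rk_Un_absorb) (use finite_ground in \<open>auto simp: closure_def\<close>)
  moreover have "X \<union> closure X = closure X" using closure_superset[OF assms] by blast
  ultimately show ?thesis by simp
qed

lemma flats_closure:
  assumes "X \<subseteq> ground M"
  shows "closure X \<in> flats M"
proof -
  have "rk M (closure X) < rk M (insert e (closure X))" if e: "e \<in> ground M - closure X" for e
  proof -
    have "rk M (insert e X) \<noteq> rk M X" using e by (auto simp: closure_def)
    moreover have "rk M X \<le> rk M (insert e X)" by (intro rk_mono) auto
    moreover have "rk M (insert e X) \<le> rk M (insert e (closure X))"
      using closure_superset[OF assms] by (intro rk_mono) auto
    ultimately show ?thesis using rk_closure[OF assms] by simp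
  qed
  then show ?thesis by (auto simp: flats_def closure_def)
qed

lemma flat_absorb:
  assumes "V \<in> flats M" "A \<subseteq> V" "e \<in> ground M" "rk M (insert e A) = rk M A"
  shows "e \<in> V"
proof -
  have "rk M (insert e A \<union> V) = rk M (A \<union> V)"
    by (rule sym, rule rk_Un_cong) (use assms in auto)
  moreover have "insert e A \<union> V = insert e V" "A \<union> V = V" using assms(2) by auto
  ultimately have "rk M (insert e V) = rk M V" by simp
  then show ?thesis using assms by (force simp: flats_def)
qed

text \<open>The bases of the restriction are the independent subsets of \<open>X\<close> of size
  \<open>rk M X\<close>, so some basis avoids \<open>e\<close> exactly when \<open>X - {e}\<close>
  has full rank. This makes cyclicity a pure rank condition.\<close>

lemma coloops_restriction_iff:
  "coloops (restriction M X) = {} \<longleftrightarrow> (\<forall>e\<in>X. rk M (X - {e}) = rk M X)"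
proof -
  have bases: "B \<in> bases (restriction M X) \<longleftrightarrow> B \<in> indeps M \<and> B \<subseteq> X \<and> card B = rk M X" for B
  proof
    assume "B \<in> bases (restriction M X)"
    then have B: "B \<in> indeps M" "B \<subseteq> X" "\<And>I. I \<in> indeps M \<Longrightarrow> I \<subseteq> X \<Longrightarrow> B \<subseteq> I \<Longrightarrow> I = B"
      by (auto simp: bases_def restriction_def)
    then show "B \<in> indeps M \<and> B \<subseteq> X \<and> card B = rk M X"
      using indep_extend[of B X] by metis
  next
    assume B: "B \<in> indeps M \<and> B \<subseteq> X \<and> card B = rk M X"
    have "I = B" if "I \<in> indeps M" "I \<subseteq> X" "B \<subseteq> I" for I
      using that B card_seteq[of I B] finite_indep card_le_rk[of I X] by auto
    then show "B \<in> bases (restriction M X)"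
      using B by (auto simp: bases_def restriction_def)
  qed
  have "(\<exists>B\<in>bases (restriction M X). e \<notin> B) \<longleftrightarrow> rk M (X - {e}) = rk M X" for e
  proof
    assume "\<exists>B\<in>bases (restriction M X). e \<notin> B"
    then obtain B where "B \<in> indeps M" "B \<subseteq> X - {e}" "card B = rk M X" using bases by blast
    then show "rk M (X - {e}) = rk M X"
      using card_le_rk[of B "X - {e}"] rk_mono[of "X - {e}" X] by auto
  next
    assume eq: "rk M (X - {e}) = rk M X"
    obtain B where "B \<in> indeps M" "B \<subseteq> X - {e}" "card B = rk M (X - {e})" using rk_witness .
    then have "B \<in> bases (restriction M X)" "e \<notin> B" using eq bases by auto
    then show "\<exists>B\<in>bases (restriction M X). e \<notin> B" by blast
  qed
  then show ?thesis by (auto simp: coloops_def restriction_def)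
qed

lemma cyclic_flats_iff:
  "X \<in> cyclic_flats M \<longleftrightarrow> X \<in> flats M \<and> (\<forall>e\<in>X. rk M (X - {e}) = rk M X)"
  by (simp add: cyclic_flats_def coloops_restriction_iff)

lemma cyclic_flat_subset_ground: "X \<in> cyclic_flats M \<Longrightarrow> X \<subseteq> ground M"
  by (simp add: cyclic_flats_def flats_def)

lemma finite_cyclic_flat: "X \<in> cyclic_flats M \<Longrightarrow> finite X"
  using cyclic_flat_subset_ground finite_ground finite_subset by blast

lemma finite_cyclic_flats: "finite (cyclic_flats M)"
  by (rule finite_subset[of _ "Pow (ground M)"])
    (use finite_ground cyclic_flat_subset_ground in auto)

lemma rk_cyclic_flat_less:
  assumes "Z \<in> cyclic_flats M" "W \<in> cyclic_flats M" "Z \<subset> W"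
  shows "rk M Z < rk M W"
proof -
  obtain e where e: "e \<in> W" "e \<notin> Z" using assms by auto
  then have "e \<in> ground M - Z" using cyclic_flat_subset_ground[OF assms(2)] by auto
  moreover have "Z \<in> flats M" using assms(1) by (simp add: cyclic_flats_def)
  ultimately have "rk M Z < rk M (insert e Z)" unfolding flats_def by blast
  also have "\<dots> \<le> rk M W" using e(1) assms(3) by (intro rk_mono) auto
  finally show ?thesis .
qed

lemma empty_cyclic_flat:
  assumes "loops M = {}"
  shows "{} \<in> cyclic_flats M"
proof -
  have "rk M {} < rk M {e}" if "e \<in> ground M" for e
  proof -
    have "{e} \<in> indeps M" using that assms by (auto simp: loops_def)
    then show ?thesis using card_le_rk[of "{e}" "{e}"] rk_le_card[of "{}"] by simp
  qed
  then show ?thesis by (auto simp: cyclic_flats_iff flats_def)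
qed

lemma ground_cyclic_flat:
  assumes "coloops M = {}"
  shows "ground M \<in> cyclic_flats M"
proof -
  have "restriction M (ground M) = M"
    using indep_subset_ground by (cases M) (auto simp: restriction_def)
  then show ?thesis using assms by (simp add: cyclic_flats_def flats_def)
qed

end

section \<open>Decomposition of subsets along cyclic flats\<close>

definition cyclic_interval :: "'a set_system \<Rightarrow> 'a set \<Rightarrow> 'a set \<Rightarrow> 'a set set" where
  "cyclic_interval M Z W = {V \<in> cyclic_flats M. Z \<subseteq> V \<and> V \<subseteq> W}"

text \<open>The coloop-free spanning sets and the independent sets of the minor \<open>(M|W)/Z\<close>:\<close>

definition minor_cyclic_spanning :: "'a set_system \<Rightarrow> 'a set \<Rightarrow> 'a set \<Rightarrow> 'a set set" where
  "minor_cyclic_spanning M Z W =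
    {Y. Y \<subseteq> W - Z \<and> rk M (Z \<union> Y) = rk M W \<and> (\<forall>e\<in>Y. rk M (Z \<union> Y - {e}) = rk M W)}"

definition minor_indeps :: "'a set_system \<Rightarrow> 'a set \<Rightarrow> 'a set \<Rightarrow> 'a set set" where
  "minor_indeps M Z W = {I. I \<subseteq> W - Z \<and> rk M (Z \<union> I) = rk M Z + card I}"

text \<open>The ground set of this minor is empty. With \<open>minor_indeps_self\<close> this
  collapses the end terms \<open>V = Z\<close> and \<open>V = W\<close> of the
  decomposition.\<close>

lemma minor_cyclic_spanning_self: "minor_cyclic_spanning M Z Z = {{}}"
  by (auto simp: minor_cyclic_spanning_def)

lemma minor_indeps_self: "minor_indeps M Z Z = {{}}"
  by (auto simp: minor_indeps_def)

context matroid
begin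

lemma finite_cyclic_interval: "finite (cyclic_interval M Z W)"
  unfolding cyclic_interval_def using finite_cyclic_flats by simp

lemma finite_minor_cyclic_spanning: "finite W \<Longrightarrow> finite (minor_cyclic_spanning M Z W)"
  by (rule finite_subset[of _ "Pow W"]) (auto simp: minor_cyclic_spanning_def)

lemma finite_minor_indeps: "finite W \<Longrightarrow> finite (minor_indeps M Z W)"
  by (rule finite_subset[of _ "Pow W"]) (auto simp: minor_indeps_def)

lemma rk_decomposed:
  assumes "Z \<subseteq> V" "Y \<in> minor_cyclic_spanning M Z V" "I \<in> minor_indeps M V W"
  shows "rk M (Z \<union> (Y \<union> I)) = rk M V + card I"
proof -
  have "rk M (Z \<union> Y \<union> I) = rk M (V \<union> I)"
    by (rule rk_Un_cong) (use assms in \<open>auto simp: minor_cyclic_spanning_def\<close>)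
  then show ?thesis using assms(3) by (simp add: minor_indeps_def Un_assoc)
qed

text \<open>For \<open>X\<close> disjoint from \<open>Z\<close>, these are the non-coloops of the
  minor \<open>(M|(Z \<union> X))/Z\<close>, so what is left of \<open>X\<close> once its coloops
  are removed.\<close>

definition core :: "'a set \<Rightarrow> 'a set \<Rightarrow> 'a set" where
  "core Z X = {e \<in> X. rk M (Z \<union> X - {e}) = rk M (Z \<union> X)}"

text \<open>Elements of \<open>Y\<close> are non-coloops already in \<open>Z \<union> Y\<close>.
  Without an \<open>e \<in> I\<close> the rank is at most \<open>rk M V + card (I - {e})\<close>,
  which is too small.\<close>

lemma core_decomposed:
  assumes "Z \<subseteq> V" "finite W" "Y \<in> minor_cyclic_spanning M Z V" "I \<in> minor_indeps M V W"
  shows "core Z (Y \<union> I) = Y"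
proof -
  let ?S = "Z \<union> (Y \<union> I)"
  have Y: "Y \<subseteq> V - Z" "rk M (Z \<union> Y) = rk M V" "\<And>e. e \<in> Y \<Longrightarrow> rk M (Z \<union> Y - {e}) = rk M V"
    using assms(3) by (auto simp: minor_cyclic_spanning_def)
  have I: "I \<subseteq> W - V" "finite I"
    using assms(2,4) by (auto simp: minor_indeps_def intro: finite_subset)
  have "rk M (?S - {e}) = rk M ?S" if "e \<in> Y" for e
    by (rule noncoloop_mono[of "Z \<union> Y"]) (use Y that in auto)
  moreover have "rk M (?S - {e}) \<noteq> rk M ?S" if "e \<in> I" for e
  proof -
    have "rk M (?S - {e}) \<le> rk M (V \<union> (I - {e}))"
      using Y(1) assms(1) by (intro rk_mono) auto
    also have "\<dots> \<le> rk M V + card (I - {e})" using I by (intro rk_Un_le) simp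
    also have "\<dots> < rk M V + card I" using card_Diff1_less[OF I(2) that] by simp
    finally show ?thesis using rk_decomposed[OF assms(1,3,4)] by simp
  qed
  ultimately show ?thesis by (auto simp: core_def)
qed

lemma closure_minor_cyclic_spanning:
  assumes "V \<in> flats M" "Z \<subseteq> V" "Y \<in> minor_cyclic_spanning M Z V"
  shows "closure (Z \<union> Y) = V"
proof
  have Y: "Z \<union> Y \<subseteq> V" "rk M (Z \<union> Y) = rk M V"
    using assms by (auto simp: minor_cyclic_spanning_def)
  show "closure (Z \<union> Y) \<subseteq> V"
    using flat_absorb[OF assms(1) Y(1)] by (auto simp: closure_def)
  have "rk M (insert e (Z \<union> Y)) = rk M (Z \<union> Y)" if "e \<in> V" for e
    using rk_mono[of "insert e (Z \<union> Y)" V] rk_mono[of "Z \<union> Y" "insert e (Z \<union> Y)"] Y that by force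
  then show "V \<subseteq> closure (Z \<union> Y)" using assms(1) by (auto simp: closure_def flats_def)
qed

text \<open>This shows that every \<open>X\<close> has a decomposition. The closure lies in
  \<open>W\<close> because \<open>W\<close> is a flat, and the coloops removed from \<open>X\<close>
  form the part that is independent over \<open>V\<close>.\<close>

lemma closure_core:
  assumes Z: "Z \<in> cyclic_flats M" and W: "W \<in> cyclic_flats M" and "Z \<subseteq> W" and X: "X \<subseteq> W - Z"
  defines "V \<equiv> closure (Z \<union> core Z X)"
  shows "V \<in> cyclic_interval M Z W"
    and "X \<inter> V \<in> minor_cyclic_spanning M Z V"
    and "X - V \<in> minor_indeps M V W"
proof -
  let ?S = "Z \<union> X" and ?Y = "core Z X"
  have YX: "?Y \<subseteq> X" by (auto simp: core_def)
  have finX: "finite X" by (rule finite_subset[of X W]) (use X finite_cyclic_flat[OF W] in auto)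
  have sub: "Z \<union> ?Y \<subseteq> ground M"
    using YX X \<open>Z \<subseteq> W\<close> cyclic_flat_subset_ground[OF W] by auto
  have SY: "?S - (X - ?Y) = Z \<union> ?Y" using X YX by auto
  have rkS: "rk M ?S = rk M (Z \<union> ?Y) + card (X - ?Y)"
    unfolding SY[symmetric] by (rule rk_Diff_coloops) (use finX in \<open>auto simp: core_def\<close>)
  \<comment> \<open>Deleting the coloops \<open>X - ?Y\<close> creates no new ones: if dropping
    \<open>e\<close> lowered the rank of \<open>Z \<union> ?Y\<close>, adding back
    \<open>X - ?Y\<close> would gain too little to reach \<open>rk M ?S\<close>.\<close>
  have nc: "rk M (Z \<union> ?Y - {e}) = rk M (Z \<union> ?Y)" if "e \<in> ?Y" for e
  proof -
    have "rk M (?S - {e}) \<le> rk M ((Z \<union> ?Y - {e}) \<union> (X - ?Y))" by (intro rk_mono) auto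
    also have "\<dots> \<le> rk M (Z \<union> ?Y - {e}) + card (X - ?Y)" using finX by (intro rk_Un_le) simp
    finally have "rk M (?S - {e}) \<le> rk M (Z \<union> ?Y - {e}) + card (X - ?Y)" .
    moreover have "rk M (?S - {e}) = rk M ?S" using that by (simp add: core_def)
    moreover have "rk M (Z \<union> ?Y - {e}) \<le> rk M (Z \<union> ?Y)" by (intro rk_mono) auto
    ultimately show ?thesis using rkS by linarith
  qed
  have supV: "Z \<union> ?Y \<subseteq> V" unfolding V_def using closure_superset[OF sub] .
  have rkV: "rk M V = rk M (Z \<union> ?Y)" unfolding V_def using rk_closure[OF sub] .
  have flat: "V \<in> flats M" unfolding V_def using flats_closure[OF sub] .
  have VW: "V \<subseteq> W"
  proof
    fix e assume "e \<in> V"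
    then have "e \<in> ground M" "rk M (insert e (Z \<union> ?Y)) = rk M (Z \<union> ?Y)"
      unfolding V_def closure_def by simp_all
    moreover have "W \<in> flats M" using W by (simp add: cyclic_flats_def)
    moreover have "Z \<union> ?Y \<subseteq> W" using YX X \<open>Z \<subseteq> W\<close> by blast
    ultimately show "e \<in> W" using flat_absorb[of W "Z \<union> ?Y" e] by simp
  qed
  have "rk M (V - {e}) = rk M V" if "e \<in> V" for e
  proof -
    \<comment> \<open>In turn, \<open>e\<close> is a non-coloop because \<open>Z\<close> is cyclic,
      by \<open>nc\<close>, or because \<open>Z \<union> ?Y\<close> spans \<open>V\<close> without
      it.\<close>
    consider "e \<in> Z" | "e \<in> ?Y" | "e \<notin> Z \<union> ?Y" by blast
    then show ?thesis
    proof cases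
      case 1
      then have "rk M (Z - {e}) = rk M Z" using Z unfolding cyclic_flats_iff by blast
      then show ?thesis by (rule noncoloop_mono) (use 1 supV in auto)
    next
      case 2
      then show ?thesis by (intro noncoloop_mono[OF nc]) (use supV in auto)
    next
      case 3
      then have "Z \<union> ?Y \<subseteq> V - {e}" using supV by auto
      then have "rk M (Z \<union> ?Y) \<le> rk M (V - {e})" by (rule rk_mono)
      moreover have "rk M (V - {e}) \<le> rk M V" by (intro rk_mono) auto
      ultimately show ?thesis using rkV by linarith
    qed
  qed
  then show "V \<in> cyclic_interval M Z W"
    using flat supV VW unfolding cyclic_interval_def cyclic_flats_iff by blast
  have XV: "X \<inter> V = ?Y"
  proof
    show "?Y \<subseteq> X \<inter> V" using YX supV by auto
    show "X \<inter> V \<subseteq> ?Y"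
    proof
      fix e assume e: "e \<in> X \<inter> V"
      show "e \<in> ?Y"
      \<comment> \<open>An \<open>e\<close> spanned by \<open>Z \<union> ?Y\<close> but outside it
        would be a non-coloop of \<open>?S\<close>, hence belong to the core after all.\<close>
      proof (rule ccontr)
        assume ne: "e \<notin> ?Y"
        then have "insert e (Z \<union> ?Y) - {e} = Z \<union> ?Y" using X e by auto
        moreover have "rk M (insert e (Z \<union> ?Y)) = rk M (Z \<union> ?Y)"
          using e unfolding V_def closure_def by blast
        ultimately have "rk M (insert e (Z \<union> ?Y) - {e}) = rk M (insert e (Z \<union> ?Y))" by simp
        then have "rk M (?S - {e}) = rk M ?S"
          by (rule noncoloop_mono) (use YX e in auto)
        then show False using ne e by (simp add: core_def)
      qed
    qed
  qed
  show "X \<inter> V \<in> minor_cyclic_spanning M Z V"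
    unfolding XV minor_cyclic_spanning_def rkV using nc supV YX X by blast
  have "X - V = X - ?Y" using XV by auto
  moreover have "rk M (V \<union> (X - ?Y)) = rk M V + card (X - ?Y)"
  proof -
    have "rk M (Z \<union> ?Y \<union> (X - ?Y)) = rk M (V \<union> (X - ?Y))"
      by (rule rk_Un_cong[OF supV rkV[symmetric]])
    moreover have "Z \<union> ?Y \<union> (X - ?Y) = ?S" using YX by auto
    ultimately show ?thesis using rkS rkV by simp
  qed
  moreover have "X - V \<subseteq> W - V" using X by blast
  ultimately show "X - V \<in> minor_indeps M V W" by (simp add: minor_indeps_def)
qed

text \<open>The inverse sends \<open>X\<close> to the closure \<open>V\<close> of
  \<open>Z \<union> core Z X\<close> and cuts \<open>X\<close> along \<open>V\<close>. It recovers
  \<open>V\<close> by \<open>core_decomposed\<close> and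
  \<open>closure_minor_cyclic_spanning\<close>, and lands in the right set by
  \<open>closure_core\<close>.\<close>

lemma bij_betw_decomposition:
  assumes Z: "Z \<in> cyclic_flats M" and W: "W \<in> cyclic_flats M" and "Z \<subseteq> W"
  shows "bij_betw (\<lambda>(V, Y, I). Y \<union> I)
    (SIGMA V:cyclic_interval M Z W. minor_cyclic_spanning M Z V \<times> minor_indeps M V W)
    (Pow (W - Z))"
proof (rule bij_betw_byWitness[where
      f' = "\<lambda>X. let V = closure (Z \<union> core Z X) in (V, X \<inter> V, X - V)"], goal_cases)
  case 1
  have "closure (Z \<union> core Z (Y \<union> I)) = V \<and> (Y \<union> I) \<inter> V = Y \<and> (Y \<union> I) - V = I"
    if "V \<in> cyclic_interval M Z W" "Y \<in> minor_cyclic_spanning M Z V" "I \<in> minor_indeps M V W"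
    for V Y I
  proof -
    have "Z \<subseteq> V" "V \<in> flats M" using that by (auto simp: cyclic_interval_def cyclic_flats_iff)
    then show ?thesis
      using that core_decomposed[of Z V W Y I] closure_minor_cyclic_spanning[of V Z Y]
        finite_cyclic_flat[OF W]
      by (auto simp: minor_cyclic_spanning_def minor_indeps_def)
  qed
  then show ?case by (auto simp: Let_def)
next
  case 2
  show ?case by (auto simp: Let_def)
next
  case 3
  show ?case by (auto simp: cyclic_interval_def minor_cyclic_spanning_def minor_indeps_def)
next
  case 4
  show ?case using closure_core[OF assms] by (force simp: Let_def)
qed

lemma sum_decomposition:
  assumes "Z \<in> cyclic_flats M" "W \<in> cyclic_flats M" "Z \<subseteq> W"
  shows "(\<Sum>X\<in>Pow (W - Z). f X) = (\<Sum>V\<in>cyclic_interval M Z W.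
    \<Sum>Y\<in>minor_cyclic_spanning M Z V. \<Sum>I\<in>minor_indeps M V W. f (Y \<union> I))"
proof -
  have fin: "finite W" "\<And>V. V \<in> cyclic_interval M Z W \<Longrightarrow> finite V"
    using assms finite_cyclic_flat by (auto simp: cyclic_interval_def)
  have "(\<Sum>X\<in>Pow (W - Z). f X) =
    (\<Sum>(V, Y, I)\<in>(SIGMA V:cyclic_interval M Z W. minor_cyclic_spanning M Z V \<times> minor_indeps M V W).
      f (Y \<union> I))"
    by (subst sum.reindex_bij_betw[OF bij_betw_decomposition[OF assms], symmetric])
      (simp add: case_prod_unfold)
  also have "\<dots> = (\<Sum>V\<in>cyclic_interval M Z W.
      \<Sum>(Y, I)\<in>minor_cyclic_spanning M Z V \<times> minor_indeps M V W. f (Y \<union> I))"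
    using fin finite_cyclic_interval finite_minor_cyclic_spanning finite_minor_indeps
    by (subst sum.Sigma) auto
  finally show ?thesis by (simp add: sum.cartesian_product)
qed

section \<open>Sizes of independent and of coloop-free spanning sets\<close>

lemma card_minor_indeps_le:
  assumes "I \<in> minor_indeps M Z W" "Z \<subseteq> W"
  shows "card I \<le> rk M W - rk M Z"
proof -
  have "Z \<union> I \<subseteq> W" "rk M (Z \<union> I) = rk M Z + card I" using assms by (auto simp: minor_indeps_def)
  then show ?thesis using rk_mono[of "Z \<union> I" W] by linarith
qed

text \<open>As the rank rises from \<open>Z\<close> to \<open>W\<close>, \<open>Y\<close> has an
  element \<open>e\<close>. Since \<open>Y - {e}\<close> still spans \<open>W\<close> over
  \<open>Z\<close>, it has at least \<open>rk M W - rk M Z\<close> elements, and \<open>Y\<close>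
  has one more.\<close>

lemma card_minor_cyclic_spanning_gt:
  assumes "Y \<in> minor_cyclic_spanning M Z W" "finite W" "rk M Z < rk M W"
  shows "card Y > rk M W - rk M Z"
proof -
  have Y: "Y \<subseteq> W - Z" "rk M (Z \<union> Y) = rk M W" "\<And>e. e \<in> Y \<Longrightarrow> rk M (Z \<union> Y - {e}) = rk M W"
    using assms(1) by (auto simp: minor_cyclic_spanning_def)
  have fin: "finite Y" using Y(1) assms(2) finite_subset by blast
  obtain e where e: "e \<in> Y" using Y(2) assms(3) by fastforce
  have "Z \<union> Y - {e} = Z \<union> (Y - {e})" using Y(1) e by auto
  then have "rk M W \<le> rk M Z + card (Y - {e})"
    using rk_Un_le[of "Y - {e}" Z] Y(3)[OF e] fin by simp
  moreover have "card (Y - {e}) < card Y" using card_Diff1_less fin e .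
  ultimately show ?thesis using assms(3) by linarith
qed

text \<open>The arbitrary weight \<open>g\<close> takes the place of a generating function by size.
  Sizes add because \<open>Y\<close> lies in \<open>V\<close> and \<open>I\<close> avoids
  \<open>V\<close>.\<close>

lemma sum_card_decomposition:
  fixes g :: "nat \<Rightarrow> 'r::comm_monoid_add"
  assumes "Z \<in> cyclic_flats M" "W \<in> cyclic_flats M" "Z \<subseteq> W"
  shows "(\<Sum>X\<in>Pow (W - Z). g (card X)) = (\<Sum>V\<in>cyclic_interval M Z W.
    \<Sum>Y\<in>minor_cyclic_spanning M Z V. \<Sum>I\<in>minor_indeps M V W. g (card Y + card I))"
proof (subst sum_decomposition[OF assms], intro sum.cong refl)
  fix V Y I
  assume "V \<in> cyclic_interval M Z W" "Y \<in> minor_cyclic_spanning M Z V" "I \<in> minor_indeps M V W"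
  then have "Y \<subseteq> W" "I \<subseteq> W" "Y \<inter> I = {}"
    by (auto simp: cyclic_interval_def minor_cyclic_spanning_def minor_indeps_def)
  moreover from this have "finite Y" "finite I"
    using finite_cyclic_flat[OF assms(2)] finite_subset by blast+
  ultimately show "g (card (Y \<union> I)) = g (card Y + card I)" by (simp add: card_Un_disjoint)
qed

end

section \<open>Invariance under isomorphism of configurations\<close>

lemma sum_Pow_card_cong:
  assumes "finite A" "finite B" "card A = card B"
  shows "(\<Sum>X\<in>Pow A. g (card X)) = (\<Sum>X\<in>Pow B. g (card X))"
proof -
  obtain h where h: "bij_betw h A B" using assms finite_same_card_bij by blast
  have "(\<Sum>X\<in>Pow B. g (card X)) = (\<Sum>X\<in>Pow A. g (card (h ` X)))"
    by (rule sum.reindex_bij_betw[OF bij_betw_Pow[OF h], symmetric])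
  also have "\<dots> = (\<Sum>X\<in>Pow A. g (card X))"
    using bij_betw_imp_inj_on[OF h] by (intro sum.cong refl arg_cong[of _ _ g] card_image)
      (auto intro: inj_on_subset)
  finally show ?thesis by simp
qed

text \<open>Applying \<open>eq\<close> to \<open>g\<close> cut off to \<open>0\<close> above
  \<open>d\<close> kills the sums over \<open>B\<close> and \<open>B'\<close> and leaves those over
  \<open>A\<close> and \<open>A'\<close> untouched. Subtraction then gives the other
  equality.\<close>

lemma sum_split_threshold:
  fixes g :: "nat \<Rightarrow> 'r::ab_group_add"
  assumes eq: "\<And>g :: nat \<Rightarrow> 'r. (\<Sum>a\<in>A. g (f a)) + (\<Sum>b\<in>B. g (f b)) =
      (\<Sum>a\<in>A'. g (f' a)) + (\<Sum>b\<in>B'. g (f' b))"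
    and "\<And>a. a \<in> A \<Longrightarrow> f a \<le> d" "\<And>a. a \<in> A' \<Longrightarrow> f' a \<le> d"
    and "\<And>b. b \<in> B \<Longrightarrow> d < f b" "\<And>b. b \<in> B' \<Longrightarrow> d < f' b"
  shows "(\<Sum>a\<in>A. g (f a)) = (\<Sum>a\<in>A'. g (f' a))" "(\<Sum>b\<in>B. g (f b)) = (\<Sum>b\<in>B'. g (f' b))"
proof -
  let ?g = "\<lambda>n. if n \<le> d then g n else 0"
  have "(\<Sum>a\<in>A. ?g (f a)) = (\<Sum>a\<in>A. g (f a))" "(\<Sum>a\<in>A'. ?g (f' a)) = (\<Sum>a\<in>A'. g (f' a))"
    using assms(2,3) by (auto intro: sum.cong)
  moreover have "(\<Sum>b\<in>B. ?g (f b)) = 0" "(\<Sum>b\<in>B'. ?g (f' b)) = 0"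
    using assms(4,5) by (force intro!: sum.neutral)+
  ultimately show "(\<Sum>a\<in>A. g (f a)) = (\<Sum>a\<in>A'. g (f' a))" using eq[of ?g] by simp
  then show "(\<Sum>b\<in>B. g (f b)) = (\<Sum>b\<in>B'. g (f' b))" using eq[of g] by simp
qed

section \<open>Minors between corresponding cyclic flats\<close>

locale configuration_iso =
  M: matroid M + M': matroid M'
  for M :: "'a set_system" and M' :: "'b set_system" +
  fixes \<phi> :: "'a set \<Rightarrow> 'b set"
  assumes bij: "bij_betw \<phi> (cyclic_flats M) (cyclic_flats M')"
    and subset_iff: "\<And>X Y. X \<in> cyclic_flats M \<Longrightarrow> Y \<in> cyclic_flats M \<Longrightarrow>
           X \<subseteq> Y \<longleftrightarrow> \<phi> X \<subseteq> \<phi> Y"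
    and card_eq: "\<And>X. X \<in> cyclic_flats M \<Longrightarrow> card (\<phi> X) = card X"
    and rk_eq: "\<And>X. X \<in> cyclic_flats M \<Longrightarrow> rk M' (\<phi> X) = rk M X"
begin

lemma image_cyclic_flat: "X \<in> cyclic_flats M \<Longrightarrow> \<phi> X \<in> cyclic_flats M'"
  using bij bij_betwE by blast

lemma bij_betw_cyclic_interval:
  assumes "Z \<in> cyclic_flats M" "W \<in> cyclic_flats M"
  shows "bij_betw \<phi> (cyclic_interval M Z W) (cyclic_interval M' (\<phi> Z) (\<phi> W))"
proof (rule bij_betw_subset[OF bij])
  have "cyclic_flats M' = \<phi> ` cyclic_flats M" using bij by (simp add: bij_betw_def)
  then show "\<phi> ` cyclic_interval M Z W = cyclic_interval M' (\<phi> Z) (\<phi> W)"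
    using assms subset_iff by (auto simp: cyclic_interval_def)
qed (auto simp: cyclic_interval_def)

text \<open>Varying \<open>g\<close> compares the size distributions in corresponding minors. Both
  claims need one joint induction on \<open>card (W - Z)\<close>: an intermediate flat contributes
  spanning sets below it and independent sets above it.\<close>

lemma sum_minor_eq:
  fixes g :: "nat \<Rightarrow> 'r::ab_group_add"
  assumes "Z \<in> cyclic_flats M" "W \<in> cyclic_flats M" "Z \<subseteq> W"
  shows "(\<Sum>I\<in>minor_indeps M Z W. g (card I)) = (\<Sum>I\<in>minor_indeps M' (\<phi> Z) (\<phi> W). g (card I))"
    and "(\<Sum>Y\<in>minor_cyclic_spanning M Z W. g (card Y)) =
      (\<Sum>Y\<in>minor_cyclic_spanning M' (\<phi> Z) (\<phi> W). g (card Y))"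
proof -
  \<comment> \<open>The weights are quantified inside the induction because its hypothesis is
    applied to shifted weights and to weights that are themselves sums.\<close>
  have "(\<forall>g :: nat \<Rightarrow> 'r. (\<Sum>I\<in>minor_indeps M Z W. g (card I)) =
        (\<Sum>I\<in>minor_indeps M' (\<phi> Z) (\<phi> W). g (card I))) \<and>
      (\<forall>g :: nat \<Rightarrow> 'r. (\<Sum>Y\<in>minor_cyclic_spanning M Z W. g (card Y)) =
        (\<Sum>Y\<in>minor_cyclic_spanning M' (\<phi> Z) (\<phi> W). g (card Y)))"
    using assms
  proof (induction "card (W - Z)" arbitrary: Z W rule: less_induct)
    case less
    note Z = less.prems(1) and W = less.prems(2) and ZW = less.prems(3)
    note Z' = image_cyclic_flat[OF Z] and W' = image_cyclic_flat[OF W]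
    have ZW': "\<phi> Z \<subseteq> \<phi> W" using subset_iff Z W ZW by blast
    have fW: "finite W" using M.finite_cyclic_flat[OF W] .
    have fW': "finite (\<phi> W)" using M'.finite_cyclic_flat[OF W'] .
    show ?case
    proof (cases "Z = W")
      case True
      then show ?thesis by (simp add: minor_cyclic_spanning_self minor_indeps_self)
    next
      case False
      let ?C = "minor_cyclic_spanning M" and ?C' = "minor_cyclic_spanning M'"
      let ?I = "minor_indeps M" and ?I' = "minor_indeps M'"
      let ?d = "rk M W - rk M Z"
      have r: "rk M Z < rk M W" using M.rk_cyclic_flat_less Z W ZW False by blast
      have r': "rk M' (\<phi> Z) < rk M' (\<phi> W)" using r rk_eq Z W by simp
      have d': "rk M' (\<phi> W) - rk M' (\<phi> Z) = ?d" using rk_eq Z W by simp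
      \<comment> \<open>Summed over all subsets of \<open>W - Z\<close>, the weights agree on both
        sides because the cardinalities do. Cancelling the intermediate flats leaves
        \<open>V = Z\<close>, which gives the independent sets, and \<open>V = W\<close>, which
        gives the spanning sets.\<close>
      have total: "(\<Sum>I\<in>?I Z W. g (card I)) + (\<Sum>Y\<in>?C Z W. g (card Y)) =
          (\<Sum>I\<in>?I' (\<phi> Z) (\<phi> W). g (card I)) + (\<Sum>Y\<in>?C' (\<phi> Z) (\<phi> W). g (card Y))"
        for g :: "nat \<Rightarrow> 'r"
      proof -
        let ?s = "\<lambda>V. \<Sum>Y\<in>?C Z V. \<Sum>I\<in>?I V W. g (card Y + card I)"
        let ?s' = "\<lambda>V. \<Sum>Y\<in>?C' (\<phi> Z) V. \<Sum>I\<in>?I' V (\<phi> W). g (card Y + card I)"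
        let ?L = "cyclic_interval M Z W" and ?L' = "cyclic_interval M' (\<phi> Z) (\<phi> W)"
        have mid: "?s V = ?s' (\<phi> V)" if V: "V \<in> ?L - {Z} - {W}" for V
        proof -
          have V1: "V \<in> cyclic_flats M" "Z \<subset> V" "V \<subset> W"
            using V by (auto simp: cyclic_interval_def)
          have "card (V - Z) < card (W - Z)" "card (W - V) < card (W - Z)"
            using V1 fW by (auto intro!: psubset_card_mono)
          note IH = less.hyps[OF this(1) Z V1(1)] less.hyps[OF this(2) V1(1) W]
          \<comment> \<open>First the independent sets above \<open>V\<close> are exchanged, with
            the weight shifted by \<open>card Y\<close>; then the spanning sets below
            \<open>V\<close>, with the whole inner sum as weight.\<close>
          have "?s V = (\<Sum>Y\<in>?C Z V. \<Sum>I\<in>?I' (\<phi> V) (\<phi> W). g (card Y + card I))"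
          proof (rule sum.cong[OF refl])
            fix Y
            show "(\<Sum>I\<in>?I V W. g (card Y + card I)) = (\<Sum>I\<in>?I' (\<phi> V) (\<phi> W). g (card Y + card I))"
              using IH(2) V1 by auto
          qed
          also have "\<dots> = ?s' (\<phi> V)"
            using IH(1)[THEN conjunct2, THEN spec,
              of "\<lambda>n. \<Sum>I\<in>?I' (\<phi> V) (\<phi> W). g (n + card I)"] V1 by auto
          finally show ?thesis .
        qed
        have in_L: "Z \<in> ?L" "W \<in> ?L" using Z W ZW by (auto simp: cyclic_interval_def)
        have split: "sum F ?L = F Z + (F W + sum F (?L - {Z} - {W}))" for F :: "'a set \<Rightarrow> 'r"
          using in_L False M.finite_cyclic_interval[of Z W]
          by (simp add: sum.remove[of ?L Z] sum.remove[of "?L - {Z}" W])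
        have "(\<Sum>X\<in>Pow (W - Z). g (card X)) = (\<Sum>X\<in>Pow (\<phi> W - \<phi> Z). g (card X))"
        proof (rule sum_Pow_card_cong)
          show "card (W - Z) = card (\<phi> W - \<phi> Z)"
            using ZW ZW' fW fW' card_eq Z W by (simp add: card_Diff_subset finite_subset)
        qed (use fW fW' in auto)
        then have "sum ?s ?L = sum ?s' ?L'"
          using M.sum_card_decomposition[OF Z W ZW, of g] M'.sum_card_decomposition[OF Z' W' ZW', of g] by simp
        also have "\<dots> = (\<Sum>V\<in>?L. ?s' (\<phi> V))"
          by (rule sum.reindex_bij_betw[OF bij_betw_cyclic_interval[OF Z W], symmetric])
        finally have "?s Z + ?s W = ?s' (\<phi> Z) + ?s' (\<phi> W)"
          unfolding split using mid by (simp add: add.assoc[symmetric])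
        then show ?thesis by (simp add: minor_cyclic_spanning_self minor_indeps_self)
      qed
      \<comment> \<open>The cutoff \<open>?d\<close> serves both matroids, as it depends only on
        ranks that \<open>\<phi>\<close> preserves.\<close>
      have thr: "\<And>I. I \<in> ?I Z W \<Longrightarrow> card I \<le> ?d" "\<And>I. I \<in> ?I' (\<phi> Z) (\<phi> W) \<Longrightarrow> card I \<le> ?d"
        "\<And>Y. Y \<in> ?C Z W \<Longrightarrow> ?d < card Y" "\<And>Y. Y \<in> ?C' (\<phi> Z) (\<phi> W) \<Longrightarrow> ?d < card Y"
        using M.card_minor_indeps_le[OF _ ZW] M'.card_minor_indeps_le[OF _ ZW']
          M.card_minor_cyclic_spanning_gt[OF _ fW r] M'.card_minor_cyclic_spanning_gt[OF _ fW' r'] d'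
        by auto
      show ?thesis
        using sum_split_threshold[OF total thr] by blast
    qed
  qed
  then show "(\<Sum>I\<in>minor_indeps M Z W. g (card I)) = (\<Sum>I\<in>minor_indeps M' (\<phi> Z) (\<phi> W). g (card I))"
    and "(\<Sum>Y\<in>minor_cyclic_spanning M Z W. g (card Y)) =
      (\<Sum>Y\<in>minor_cyclic_spanning M' (\<phi> Z) (\<phi> W). g (card Y))"
    by blast+
qed

end

section \<open>Comparison of the rank generating polynomials\<close>

text \<open>Adding \<open>I\<close> raises size and rank equally, so for fixed \<open>V\<close> the
  exponent of \<open>var_y\<close> depends only on \<open>card Y\<close> and that of
  \<open>var_x\<close> only on \<open>card I\<close>. This is the form to which
  \<open>sum_minor_eq\<close> applies.\<close>

lemma (in matroid) rank_gen_poly_decomposition: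
  assumes E: "{} \<in> cyclic_flats M" "ground M \<in> cyclic_flats M"
  shows "rank_gen_poly M = (\<Sum>V\<in>cyclic_interval M {} (ground M).
    \<Sum>Y\<in>minor_cyclic_spanning M {} V. \<Sum>I\<in>minor_indeps M V (ground M).
      var_x ^ (rk M (ground M) - (rk M V + card I)) * var_y ^ (card Y - rk M V))"
proof -
  let ?E = "ground M"
  have "rank_gen_poly M = (\<Sum>X\<in>Pow (?E - {}). var_x ^ (rk M ?E - rk M X) * var_y ^ (card X - rk M X))"
    by (simp add: rank_gen_poly_def)
  also have "\<dots> = (\<Sum>V\<in>cyclic_interval M {} ?E.
    \<Sum>Y\<in>minor_cyclic_spanning M {} V. \<Sum>I\<in>minor_indeps M V ?E.
      var_x ^ (rk M ?E - (rk M V + card I)) * var_y ^ (card Y - rk M V))"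
  proof (subst sum_decomposition[OF E empty_subsetI], intro sum.cong refl)
    fix V Y I
    assume *: "V \<in> cyclic_interval M {} ?E" "Y \<in> minor_cyclic_spanning M {} V"
      "I \<in> minor_indeps M V ?E"
    then have "Y \<subseteq> ?E" "I \<subseteq> ?E" "Y \<inter> I = {}"
      by (auto simp: cyclic_interval_def minor_cyclic_spanning_def minor_indeps_def)
    moreover from this have "finite Y" "finite I"
      using finite_ground finite_subset by blast+
    ultimately have "card (Y \<union> I) = card Y + card I" by (simp add: card_Un_disjoint)
    moreover have "rk M (Y \<union> I) = rk M V + card I" using rk_decomposed[of "{}" V Y I ?E] * by simp
    ultimately show "var_x ^ (rk M ?E - rk M (Y \<union> I)) * var_y ^ (card (Y \<union> I) - rk M (Y \<union> I)) =
      var_x ^ (rk M ?E - (rk M V + card I)) * var_y ^ (card Y - rk M V)" by simp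
  qed
  finally show ?thesis .
qed

theorem theorem4p3:
  fixes M :: "'a set_system" and M' :: "'b set_system"
    and \<phi> :: "'a set \<Rightarrow> 'b set"
  assumes "matroid M" and "matroid M'"
    and "loops M = {}" and "coloops M = {}"
    and "loops M' = {}" and "coloops M' = {}"
    and "bij_betw \<phi> (cyclic_flats M) (cyclic_flats M')"
    and "\<And>X Y. X \<in> cyclic_flats M \<Longrightarrow> Y \<in> cyclic_flats M \<Longrightarrow>
           X \<subseteq> Y \<longleftrightarrow> \<phi> X \<subseteq> \<phi> Y"
    and "\<And>X. X \<in> cyclic_flats M \<Longrightarrow> card (\<phi> X) = card X"
    and "\<And>X. X \<in> cyclic_flats M \<Longrightarrow> rk M' (\<phi> X) = rk M X"
  shows "rank_gen_poly M = rank_gen_poly M' \<and> tutte_poly M = tutte_poly M'"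
proof -
  interpret configuration_iso M M' \<phi>
    using assms by (intro configuration_iso.intro configuration_iso_axioms.intro)
  let ?E = "ground M" and ?E' = "ground M'"
  note bot = M.empty_cyclic_flat[OF assms(3)] and top = M.ground_cyclic_flat[OF assms(4)]
  note bot' = M'.empty_cyclic_flat[OF assms(5)] and top' = M'.ground_cyclic_flat[OF assms(6)]
  \<comment> \<open>Cardinality \<open>0\<close> would also fit an infinite set, so finiteness is
    established first.\<close>
  have "finite (\<phi> {})" by (rule M'.finite_cyclic_flat[OF image_cyclic_flat[OF bot]])
  moreover have "card (\<phi> {}) = 0" using card_eq[OF bot] by (rule trans) (rule card.empty)
  ultimately have phi_bot: "\<phi> {} = {}" by (rule iffD1[OF card_0_eq])
  \<comment> \<open>The preimage \<open>X\<close> of \<open>?E'\<close> lies in \<open>?E\<close>,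
    so monotonicity gives \<open>?E' \<subseteq> \<phi> ?E\<close>; the reverse inclusion holds
    since \<open>\<phi> ?E\<close> is a cyclic flat of \<open>M'\<close>.\<close>
  have "?E' \<in> \<phi> ` cyclic_flats M" using top' unfolding bij_betw_imp_surj_on[OF bij] .
  then obtain X where X: "X \<in> cyclic_flats M" "\<phi> X = ?E'" by (metis imageE)
  have "\<phi> X \<subseteq> \<phi> ?E" using subset_iff[OF X(1) top] M.cyclic_flat_subset_ground[OF X(1)] by simp
  then have phi_top: "\<phi> ?E = ?E'"
    using X(2) M'.cyclic_flat_subset_ground[OF image_cyclic_flat[OF top]] by auto
  let ?C = "minor_cyclic_spanning M {}" and ?C' = "minor_cyclic_spanning M' {}"
  let ?I = "\<lambda>V. minor_indeps M V ?E" and ?I' = "\<lambda>V. minor_indeps M' V ?E'"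
  let ?t = "\<lambda>V i j. var_x ^ (rk M ?E - (rk M V + j)) * var_y ^ (i - rk M V)"
  let ?t' = "\<lambda>V i j. var_x ^ (rk M' ?E' - (rk M' V + j)) * var_y ^ (i - rk M' V)"
  have "(\<Sum>Y\<in>?C V. \<Sum>I\<in>?I V. ?t V (card Y) (card I)) =
      (\<Sum>Y\<in>?C' (\<phi> V). \<Sum>I\<in>?I' (\<phi> V). ?t' (\<phi> V) (card Y) (card I))"
    if "V \<in> cyclic_interval M {} ?E" for V
  proof -
    have V: "V \<in> cyclic_flats M" "V \<subseteq> ?E" using that by (auto simp: cyclic_interval_def)
    have r: "rk M' (\<phi> V) = rk M V" "rk M' ?E' = rk M ?E"
      using rk_eq[OF V(1)] rk_eq[OF top] phi_top by simp_all
    \<comment> \<open>For fixed \<open>Y\<close> the summand is a weight in \<open>card I\<close>,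
      used on the minor from \<open>V\<close> to \<open>?E\<close>. The resulting inner sum is a
      weight in \<open>card Y\<close>, used on the minor from \<open>{}\<close> to
      \<open>V\<close>.\<close>
    have "(\<Sum>Y\<in>?C V. \<Sum>I\<in>?I V. ?t V (card Y) (card I)) =
        (\<Sum>Y\<in>?C V. \<Sum>I\<in>?I' (\<phi> V). ?t V (card Y) (card I))"
      using sum_minor_eq(1)[OF V(1) top V(2)] phi_top by (intro sum.cong refl) simp
    also have "\<dots> = (\<Sum>Y\<in>?C' (\<phi> V). \<Sum>I\<in>?I' (\<phi> V). ?t V (card Y) (card I))"
      using sum_minor_eq(2)[OF bot V(1) empty_subsetI,
          of "\<lambda>i. \<Sum>I\<in>?I' (\<phi> V). ?t V i (card I)"] phi_bot by simp
    finally show ?thesis unfolding r .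
  qed
  then have "rank_gen_poly M = (\<Sum>V\<in>cyclic_interval M {} ?E.
      \<Sum>Y\<in>?C' (\<phi> V). \<Sum>I\<in>?I' (\<phi> V). ?t' (\<phi> V) (card Y) (card I))"
    unfolding M.rank_gen_poly_decomposition[OF bot top] by (rule sum.cong[OF refl])
  also have "\<dots> = rank_gen_poly M'"
    unfolding M'.rank_gen_poly_decomposition[OF bot' top']
    using sum.reindex_bij_betw[OF bij_betw_cyclic_interval[OF bot top]] phi_bot phi_top by simp
  \<comment> \<open>The Tutte polynomial is a substitution into the rank generating polynomial, so
    the second equality follows from the first.\<close>
  finally show ?thesis by (simp add: tutte_poly_def)
qed

end
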